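(* For every integer $t\geq 3$ there exists a constant $C$ such that, letting $H_t$ be the subdivision of $K_t$, we have $\mathrm{ex}(n,H_t)\leq Cn^{3/2-1/6^t}$ for all $n$.
   Context: The subdivision of a graph $F$ is the graph obtained from $F$ by replacing each edge by a path of length $2$, the new middle vertices being distinct for distinct edges. $\mathrm{ex}(n,H)$ is the largest number of edges in an $n$-vertex graph containing no copy of $H$. *)

theory Defs
  imports Complex_Main "HOL-Library.Ramsey"
begin

text \<open>Finite simple graphs, as a vertex set together with a set of two-element subsets of it.\<close>

type_synonym 'a graph = "'a set \<times> 'a set set"

abbreviation verts :: "'a graph \<Rightarrow> 'a set" where
  "verts G \<equiv> fst G"

abbreviation edges :: "'a graph \<Rightarrow> 'a set set" where
  "edges G \<equiv> snd G"

definition simple_graph :: "'a graph \<Rightarrow> bool" where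
  "simple_graph G \<longleftrightarrow> finite (verts G) \<and> edges G \<subseteq> nsets (verts G) 2"

definition complete_graph :: "nat \<Rightarrow> nat graph" where
  "complete_graph t = ({..<t}, nsets {..<t} 2)"

text \<open>
  The original vertices are tagged by \<open>Inl\<close>; the new middle vertex of the edge \<open>e\<close> is \<open>Inr e\<close>,
  so that distinct edges get distinct middle vertices. The edge \<open>e = {u, v}\<close> becomes the path
  \<open>Inl u\<close>, \<open>Inr e\<close>, \<open>Inl v\<close>.
\<close>

definition subdivision :: "'a graph \<Rightarrow> ('a + 'a set) graph" where
  "subdivision F = (Inl ` verts F \<union> Inr ` edges F, {{Inl v, Inr e} | v e. e \<in> edges F \<and> v \<in> e})"

text \<open>A copy is a not necessarily induced subgraph isomorphic to \<open>H\<close>.\<close>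

definition contains_copy :: "'a graph \<Rightarrow> 'b graph \<Rightarrow> bool" where
  "contains_copy G H \<longleftrightarrow>
     (\<exists>f. inj_on f (verts H) \<and> f ` verts H \<subseteq> verts G \<and> (\<forall>e \<in> edges H. f ` e \<in> edges G))"

text \<open>
  Every finite graph is isomorphic to one whose vertices are natural numbers, so it is enough to
  consider those. If \<open>H\<close> has an edge, the maximum below is over a finite nonempty set
  (see \<open>ex_set_finite\<close>, \<open>ex_set_nonempty\<close>).
\<close>

definition ex :: "nat \<Rightarrow> 'b graph \<Rightarrow> nat" where
  "ex n H = Max {card (edges G) | G :: nat graph.
                   simple_graph G \<and> card (verts G) = n \<and> \<not> contains_copy G H}"

lemma simple_graph_complete_graph: "simple_graph (complete_graph t)"
  by (simp add: simple_graph_def complete_graph_def)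

lemma simple_graph_subdivision:
  assumes "simple_graph F"
  shows "simple_graph (subdivision F)"
proof -
  have "edges F \<subseteq> Pow (verts F)"
    using assms by (auto simp: simple_graph_def nsets_def)
  moreover from this have "finite (edges F)"
    using assms finite_subset by (auto simp: simple_graph_def)
  ultimately show ?thesis
    using assms by (fastforce simp: simple_graph_def subdivision_def)
qed

lemma ex_set_finite:
  "finite {card (edges G) | G :: nat graph.
             simple_graph G \<and> card (verts G) = n \<and> \<not> contains_copy G H}"
proof (rule finite_subset)
  show "{card (edges G) | G :: nat graph.
           simple_graph G \<and> card (verts G) = n \<and> \<not> contains_copy G H} \<subseteq> {..n choose 2}"
  proof clarsimp
    fix V :: "nat set" and E
    assume "simple_graph (V, E)"
    then have "finite V" "E \<subseteq> nsets V 2" by (auto simp: simple_graph_def)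
    then have "card E \<le> card (nsets V 2)"
      by (intro card_mono finite_imp_finite_nsets)
    also have "\<dots> = card V choose 2" using \<open>finite V\<close> by simp
    finally show "card E \<le> card V choose 2" .
  qed
qed simp

lemma ex_set_nonempty:
  assumes "edges H \<noteq> {}"
  shows "{card (edges G) | G :: nat graph.
            simple_graph G \<and> card (verts G) = n \<and> \<not> contains_copy G H} \<noteq> {}"
proof -
  have "simple_graph ({..<n}, {})" "\<not> contains_copy ({..<n}, {}) H"
    using assms by (auto simp: simple_graph_def contains_copy_def)
  then show ?thesis by force
qed

lemma edges_subdivision_complete_graph:
  assumes "t \<ge> 2"
  shows "edges (subdivision (complete_graph t)) \<noteq> {}"
proof -
  have "{0, 1} \<in> edges (complete_graph t)"
    using assms by (simp add: complete_graph_def)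
  then show ?thesis by (auto simp: subdivision_def)
qed

end

theory Submission
  imports Defs "HOL-Analysis.Convex"
begin

text \<open>
  The argument follows Janzer's counting of light pairs. Call two vertices heavy if they have at
  least \<open>t\<^sup>2\<close> common neighbours, and light if they have fewer, but at least one. Connecting vertices
  for a clique of \<open>t\<close> pairwise heavy vertices can be chosen greedily, so a graph without a copy has no
  such clique; hence in every neighbourhood a positive proportion of the pairs is light, and every
  vertex set with enough incident edges contains many light pairs. This yields a long chain of
  vertices, each picked in the light neighbourhood of the previous ones. Lightness and a bound \<open>\<Delta>\<close>
  on the maximum degree imply that few vertices must be discarded to keep the connecting vertices
  distinct, so \<open>t\<close> pairwise light vertices also span a copy.

  No regularization of the graph is needed: the same count bounds the degree sum over a set \<open>U\<close> by
  \<open>2 t\<^sup>2 (n + \<surd>n |U|)\<close>, so the vertices of degree more than \<open>n\<^bsup>3/4\<^esup>\<close> cover only \<open>O(n)\<close> edges and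
  can be isolated, and at least \<open>n\<^bsup>1-\<epsilon>\<^esup>\<close> vertices have degree at least half of the average. The loss
  is affordable because \<open>\<epsilon> = 6\<^bsup>-t\<^esup>\<close> is tiny compared with \<open>1/t\<close>.
\<close>

section \<open>Heavy and light pairs, and greedy cliques in dense relations\<close>

definition nbhd :: "'a set set \<Rightarrow> 'a \<Rightarrow> 'a set" where
  "nbhd E x = {y. {x, y} \<in> E}"

lemma nbhd_commute: "y \<in> nbhd E x \<longleftrightarrow> x \<in> nbhd E y"
  by (simp add: nbhd_def insert_commute)

definition heavy :: "'a set set \<Rightarrow> nat \<Rightarrow> 'a \<Rightarrow> 'a \<Rightarrow> bool" where
  "heavy E T x y \<longleftrightarrow> x \<noteq> y \<and> T \<le> card (nbhd E x \<inter> nbhd E y)"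

definition light :: "'a set set \<Rightarrow> nat \<Rightarrow> 'a \<Rightarrow> 'a \<Rightarrow> bool" where
  "light E T x y \<longleftrightarrow> x \<noteq> y \<and> nbhd E x \<inter> nbhd E y \<noteq> {} \<and> card (nbhd E x \<inter> nbhd E y) < T"

lemma heavy_commute: "heavy E T x y \<longleftrightarrow> heavy E T y x"
  by (auto simp: heavy_def Int_commute)

lemma light_commute: "light E T x y \<longleftrightarrow> light E T y x"
  by (auto simp: light_def Int_commute)

text \<open>Each chosen vertex rules out at most \<open>m / t\<close> vertices, itself included by
  irreflexivity. So after \<open>s\<close> choices a vertex is still left, which gives
  \<open>Suc s\<close> in all. The induction passes to the neighbours of the chosen vertex and keeps
  \<open>m\<close> fixed while \<open>Y\<close> shrinks.\<close>

lemma greedy_clique: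
  fixes R :: "'a \<Rightarrow> 'a \<Rightarrow> bool"
  assumes sym: "\<And>x y. R x y \<Longrightarrow> R y x" and irrefl: "\<And>x. \<not> R x x"
    and "finite Y" and "\<And>x. x \<in> Y \<Longrightarrow> t * card {y \<in> Y. \<not> R x y} \<le> m" and "s * m < t * card Y"
  shows "\<exists>K\<subseteq>Y. card K = Suc s \<and> pairwise R K"
  using assms(3-)
proof (induction s arbitrary: Y)
  case 0
  then obtain x where "x \<in> Y" by fastforce
  then show ?case by (intro exI[of _ "{x}"]) (auto simp: pairwise_def)
next
  case (Suc s)
  then have "0 < card Y" by (metis gr_zeroI mult_0_right not_less0)
  then obtain x where x: "x \<in> Y" by fastforce
  let ?Z = "{y \<in> Y. R x y}"
  have "card Y = card ?Z + card {y \<in> Y. \<not> R x y}"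
    using Suc.prems(1) by (subst card_Un_disjoint[symmetric]) (auto intro!: arg_cong[of _ _ card])
  then have "t * card Y = t * card ?Z + t * card {y \<in> Y. \<not> R x y}"
    by (simp add: distrib_left)
  then have big: "s * m < t * card ?Z"
    using Suc.prems(2)[OF x] Suc.prems(3) by simp
  have "t * card {y \<in> ?Z. \<not> R z y} \<le> m" if "z \<in> ?Z" for z
  proof -
    have "card {y \<in> ?Z. \<not> R z y} \<le> card {y \<in> Y. \<not> R z y}"
      using Suc.prems(1) by (intro card_mono) auto
    then have "t * card {y \<in> ?Z. \<not> R z y} \<le> t * card {y \<in> Y. \<not> R z y}" by simp
    also have "\<dots> \<le> m" using Suc.prems(2) that by blast
    finally show ?thesis .
  qed
  from Suc.IH[OF _ this big] Suc.prems(1)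
  obtain K where K: "K \<subseteq> ?Z" "card K = Suc s" "pairwise R K"
    by auto
  have "x \<notin> K" using K(1) irrefl by auto
  moreover have "finite K" using K(2) card.infinite by force
  ultimately have "card (insert x K) = Suc (Suc s)" using K(2) by simp
  moreover have "pairwise R (insert x K)"
    using K(1,3) sym by (auto simp: pairwise_insert)
  moreover have "insert x K \<subseteq> Y" using K(1) x by auto
  ultimately show ?case by blast
qed

text \<open>A weak Turan bound. The vertices with at most \<open>card X / t\<close> non-neighbours
  form \<open>Y\<close>, where a greedy clique of size \<open>t\<close> would start if
  \<open>Y\<close> had more than a \<open>1 - 1 / t\<close> share of \<open>X\<close>. So at least
  \<open>card X / t\<close> vertices have more than \<open>card X / t\<close> non-neighbours each.
  Pairs are ordered and include the diagonal.\<close>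

lemma many_nonadjacent_pairs:
  fixes R :: "'a \<Rightarrow> 'a \<Rightarrow> bool"
  assumes sym: "\<And>x y. R x y \<Longrightarrow> R y x" and irrefl: "\<And>x. \<not> R x x" and X: "finite X" and t: "0 < t"
    and free: "\<And>K. K \<subseteq> X \<Longrightarrow> card K = t \<Longrightarrow> \<not> pairwise R K"
  shows "(card X)\<^sup>2 \<le> t\<^sup>2 * card {(x, y). x \<in> X \<and> y \<in> X \<and> \<not> R x y}"
proof -
  define m where "m = card X"
  define g where "g x = card {y \<in> X. \<not> R x y}" for x
  define Y where "Y = {x \<in> X. t * g x \<le> m}"
  have YX: "Y \<subseteq> X" "finite Y" using X by (auto simp: Y_def)
  have "\<not> (t - 1) * m < t * card Y"
  proof
    assume big: "(t - 1) * m < t * card Y"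
    have "t * card {y \<in> Y. \<not> R x y} \<le> m" if "x \<in> Y" for x
    proof -
      have "card {y \<in> Y. \<not> R x y} \<le> g x"
        unfolding g_def using X YX by (intro card_mono) auto
      then show ?thesis using that unfolding Y_def
        by (metis (no_types, lifting) le_trans mem_Collect_eq mult_le_mono2)
    qed
    from greedy_clique[OF sym irrefl YX(2) this big] free YX(1) t show False by fastforce
  qed
  moreover have "card (X - Y) = m - card Y" "card Y \<le> m"
    using YX X by (auto simp: m_def card_Diff_subset card_mono)
  ultimately have "m \<le> t * card (X - Y)"
    using t by (cases t) (auto simp: algebra_simps)
  then have "m * m \<le> t * (card (X - Y) * m)"
    by (metis mult.assoc mult_le_mono1)
  also have "card (X - Y) * m = (\<Sum>x\<in>X - Y. m)" by simp
  also have "\<dots> \<le> (\<Sum>x\<in>X - Y. t * g x)"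
    by (intro sum_mono) (auto simp: Y_def)
  also have "\<dots> \<le> (\<Sum>x\<in>X. t * g x)"
    using X by (intro sum_mono2) auto
  also have "\<dots> = t * (\<Sum>x\<in>X. g x)" by (simp add: sum_distrib_left)
  also have "(\<Sum>x\<in>X. g x) = card (SIGMA x:X. {y \<in> X. \<not> R x y})"
    using X by (simp add: g_def)
  also have "(SIGMA x:X. {y \<in> X. \<not> R x y}) = {(x, y). x \<in> X \<and> y \<in> X \<and> \<not> R x y}"
    by auto
  finally show ?thesis by (simp add: m_def power2_eq_square mult.assoc)
qed

section \<open>Choosing connecting vertices and assembling a copy of the subdivided clique\<close>

text \<open>Greedy choice: a chosen representative joins the forbidden set \<open>X\<close> while
  its index leaves \<open>I\<close>, so \<open>card I + card X\<close> does not grow and the size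
  condition survives.\<close>

lemma distinct_representatives_avoiding:
  assumes "finite I" and "finite X" and "\<And>i. i \<in> I \<Longrightarrow> card I + card X \<le> card (A i)"
  shows "\<exists>m. inj_on m I \<and> (\<forall>i\<in>I. m i \<in> A i - X)"
  using assms
proof (induction I arbitrary: X rule: finite_induct)
  case empty
  then show ?case by simp
next
  case (insert i I)
  have "card X < card (A i)" using insert.prems(2)[of i] insert.hyps by simp
  then obtain a where a: "a \<in> A i" "a \<notin> X"
    using insert.prems(1) by (meson card_mono linorder_not_le subsetI)
  have "\<exists>m. inj_on m I \<and> (\<forall>j\<in>I. m j \<in> A j - insert a X)"
    using insert.prems insert.hyps a by (intro insert.IH) fastforce+
  then obtain m where m: "inj_on m I" "\<forall>j\<in>I. m j \<in> A j - insert a X" by blast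
  have "inj_on (m(i := a)) (insert i I)"
    using m insert.hyps by (auto simp: inj_on_def)
  moreover have "\<forall>j\<in>insert i I. (m(i := a)) j \<in> A j - X"
    using m a by auto
  ultimately show ?case by blast
qed

text \<open>\<open>S\<close> carries the original vertices of the clique and \<open>m\<close> the
  middle vertices, transported along a bijection \<open>h\<close> from \<open>{..<t}\<close>. That
  \<open>m\<close> avoids \<open>S\<close> separates the images of the two vertex classes.\<close>

lemma contains_subdivisionI:
  fixes m :: "'a set \<Rightarrow> 'a"
  assumes "S \<subseteq> V" "finite S" "card S = t" and inj: "inj_on m (nsets S 2)"
    and m: "\<And>e. e \<in> nsets S 2 \<Longrightarrow> m e \<in> V - S"
    and E: "\<And>e v. e \<in> nsets S 2 \<Longrightarrow> v \<in> e \<Longrightarrow> {v, m e} \<in> E"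
  shows "contains_copy (V, E) (subdivision (complete_graph t))"
proof -
  obtain h where h: "bij_betw h {..<t} S"
    using assms(2,3) by (metis ex_bij_betw_nat_finite lessThan_atLeast0)
  have hi: "h ` e \<in> nsets S 2" if "e \<in> nsets {..<t} 2" for e
    using h that unfolding nsets_def bij_betw_def
    by (auto simp: card_image inj_on_subset)
  have hinj: "h ` e = h ` e' \<Longrightarrow> e = e'" if "e \<in> nsets {..<t} 2" "e' \<in> nsets {..<t} 2" for e e'
    using h that unfolding nsets_def bij_betw_def
    by (metis (no_types, lifting) inj_on_image_eq_iff mem_Collect_eq)
  define f where "f = case_sum h (\<lambda>e. m (h ` e))"
  have vs: "verts (subdivision (complete_graph t)) = Inl ` {..<t} \<union> Inr ` nsets {..<t} 2"
    by (simp add: subdivision_def complete_graph_def)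
  have "inj_on f (Inl ` {..<t})"
    using bij_betw_imp_inj_on[OF h] by (simp add: f_def inj_on_def)
  moreover have "inj_on f (Inr ` nsets {..<t} 2)"
    using hi hinj inj by (auto simp: f_def inj_on_def)
  moreover have "f x \<noteq> f y" if "x \<in> Inl ` {..<t}" "y \<in> Inr ` nsets {..<t} 2" for x y
  proof -
    obtain i e where "x = Inl i" "i < t" "y = Inr e" "e \<in> nsets {..<t} 2" using \<open>x \<in> _\<close> \<open>y \<in> _\<close> by auto
    moreover have "h i \<in> S" using bij_betwE[OF h] \<open>i < t\<close> by simp
    ultimately show ?thesis using m[OF hi, of e] by (auto simp: f_def)
  qed
  \<comment> \<open>Disjointness of the two images, in the form that \<open>inj_on_Un\<close> asks
    for.\<close>
  then have "f ` (A - B) \<inter> f ` (B - A) = {}"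
    if "A = Inl ` {..<t}" "B = Inr ` nsets {..<t} 2" for A B using that by blast
  ultimately have "inj_on f (verts (subdivision (complete_graph t)))"
    unfolding vs inj_on_Un by simp
  moreover have "f ` verts (subdivision (complete_graph t)) \<subseteq> V"
    unfolding vs using m[OF hi] bij_betwE[OF h] assms(1) by (auto simp: f_def)
  moreover have "f ` e \<in> E" if "e \<in> edges (subdivision (complete_graph t))" (is "e \<in> ?F") for e
  proof -
    obtain v e' where "e' \<in> nsets {..<t} 2" "v \<in> e'" "e = {Inl v, Inr e'}"
      using \<open>e \<in> ?F\<close> unfolding subdivision_def complete_graph_def fst_conv snd_conv by blast
    then show ?thesis using E[OF hi, of e' "h v"] by (auto simp: f_def)
  qed
  ultimately show ?thesis unfolding contains_copy_def by (metis fst_conv snd_conv)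
qed

section \<open>Degrees, light pairs and heavy cliques in a finite graph\<close>

locale fin_graph =
  fixes V :: "'a set" and E :: "'a set set"
  assumes finite_V: "finite V" and edges_subset: "E \<subseteq> nsets V 2"
begin

lemma nbhd_subset: "nbhd E x \<subseteq> V"
  using edges_subset by (auto simp: nbhd_def nsets_def)

lemma nbhd_irrefl: "x \<notin> nbhd E x"
  using edges_subset by (auto simp: nbhd_def nsets_def)

lemma finite_nbhd: "finite (nbhd E x)"
  using nbhd_subset finite_V by (rule finite_subset)

lemma finite_E: "finite E"
  using edges_subset finite_V by (meson finite_imp_finite_nsets finite_subset)

lemma card_nbhd: "card (nbhd E x) = card {e \<in> E. x \<in> e}"
proof (rule bij_betw_same_card)
  show "bij_betw (\<lambda>y. {x, y}) (nbhd E x) {e \<in> E. x \<in> e}"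
  proof (rule bij_betw_imageI)
    show "inj_on (\<lambda>y. {x, y}) (nbhd E x)" by (auto simp: inj_on_def doubleton_eq_iff)
    show "(\<lambda>y. {x, y}) ` nbhd E x = {e \<in> E. x \<in> e}"
    proof
      show "{e \<in> E. x \<in> e} \<subseteq> (\<lambda>y. {x, y}) ` nbhd E x"
      proof clarify
        fix e assume "e \<in> E" "x \<in> e"
        moreover from this have "card e = 2" using edges_subset by (auto simp: nsets_def)
        ultimately obtain y where "e = {x, y}" by (auto simp: card_2_iff)
        then show "e \<in> (\<lambda>y. {x, y}) ` nbhd E x" using \<open>e \<in> E\<close> by (auto simp: nbhd_def)
      qed
    qed (auto simp: nbhd_def)
  qed
qed

lemma sum_card_nbhd: "(\<Sum>v\<in>V. card (nbhd E v)) = 2 * card E"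
proof -
  have "card {v \<in> V. v \<in> e} = 2" if "e \<in> E" for e
  proof -
    have "{v \<in> V. v \<in> e} = e" "card e = 2" using that edges_subset by (auto simp: nsets_def)
    then show ?thesis by simp
  qed
  then have "(\<Sum>v\<in>V. card {e \<in> E. v \<in> e}) = 2 * card E"
    using sum_multicount[OF finite_V finite_E] by blast
  then show ?thesis by (simp add: card_nbhd)
qed

lemma sum_card_nbhd_Int:
  assumes "U \<subseteq> V"
  shows "(\<Sum>b\<in>V. card (nbhd E b \<inter> U)) = (\<Sum>u\<in>U. card (nbhd E u))"
proof -
  have "card {b \<in> V. u \<in> nbhd E b} = card (nbhd E u)" for u
    using nbhd_subset[of u] by (intro arg_cong[of _ _ card]) (auto simp: nbhd_commute)
  then have "(\<Sum>b\<in>V. card {u \<in> U. u \<in> nbhd E b}) = (\<Sum>u\<in>U. card (nbhd E u))"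
    using finite_V finite_subset[OF assms] by (intro sum_multicount_gen) auto
  moreover have "{u \<in> U. u \<in> nbhd E b} = nbhd E b \<inter> U" for b by auto
  ultimately show ?thesis by simp
qed

definition light_pairs :: "nat \<Rightarrow> 'a set \<Rightarrow> ('a \<times> 'a) set" where
  "light_pairs T U = {(x, y). x \<in> U \<and> y \<in> U \<and> light E T x y}"

lemma finite_light_pairs: "U \<subseteq> V \<Longrightarrow> finite (light_pairs T U)"
  by (rule finite_subset[of _ "V \<times> V"]) (auto simp: light_pairs_def finite_V)

text \<open>Inside a neighbourhood every non-heavy pair is light, so each neighbourhood without a heavy
  clique contributes a positive proportion of its pairs.\<close>

lemma light_pairs_lower_bound:
  fixes U :: "'a set" and t T :: nat
  defines "D \<equiv> (\<Sum>u\<in>U. card (nbhd E u))"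
  assumes U: "U \<subseteq> V" and t: "0 < t"
    and free: "\<And>K. K \<subseteq> V \<Longrightarrow> card K = t \<Longrightarrow> \<not> pairwise (heavy E T) K"
  shows "D\<^sup>2 \<le> card V * (t\<^sup>2 * (T * card (light_pairs T U) + D))"
proof -
  let ?X = "\<lambda>b. nbhd E b \<inter> U"
  \<comment> \<open>The light pairs in \<open>U\<close> that have \<open>b\<close> as a common
    neighbour. A light pair occurs for fewer than \<open>T\<close> vertices \<open>b\<close>, which
    bounds the sum of \<open>card (?P b)\<close> over \<open>b\<close>.\<close>
  let ?P = "\<lambda>b. {p \<in> light_pairs T U. b \<in> nbhd E (fst p) \<inter> nbhd E (snd p)}"
  have finU: "finite U" using U finite_V by (rule finite_subset)
  have local_bound: "(card (?X b))\<^sup>2 \<le> t\<^sup>2 * (card (?P b) + card (?X b))" for b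
  proof -
    have "(card (?X b))\<^sup>2 \<le> t\<^sup>2 * card {(x, y). x \<in> ?X b \<and> y \<in> ?X b \<and> \<not> heavy E T x y}"
    proof (rule many_nonadjacent_pairs)
      show "\<not> pairwise (heavy E T) K" if "K \<subseteq> ?X b" "card K = t" for K
        using free[of K] that U by blast
    qed (use finU t heavy_commute in \<open>auto simp: heavy_def Int_commute\<close>)
    \<comment> \<open>Two vertices of \<open>?X b\<close> share the neighbour \<open>b\<close>, so a
      pair that is not heavy is either light or on the diagonal. The diagonal is the source of the
      linear term \<open>D\<close>.\<close>
    also have "{(x, y). x \<in> ?X b \<and> y \<in> ?X b \<and> \<not> heavy E T x y} \<subseteq> ?P b \<union> (\<lambda>x. (x, x)) ` ?X b"
      using nbhd_commute[of _ E b] by (auto simp: heavy_def light_pairs_def light_def)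
    then have "card {(x, y). x \<in> ?X b \<and> y \<in> ?X b \<and> \<not> heavy E T x y}
        \<le> card (?P b \<union> (\<lambda>x. (x, x)) ` ?X b)"
      using finite_light_pairs[OF U] finU by (intro card_mono) auto
    also have "\<dots> \<le> card (?P b) + card ((\<lambda>x. (x, x)) ` ?X b)" by (rule card_Un_le)
    also have "\<dots> \<le> card (?P b) + card (?X b)"
      using finU by (simp add: card_image_le)
    finally show ?thesis by simp
  qed
  have "(\<Sum>b\<in>V. card (?P b)) = (\<Sum>p\<in>light_pairs T U. card (nbhd E (fst p) \<inter> nbhd E (snd p)))"
  proof (intro sum_multicount_gen finite_V finite_light_pairs[OF U] ballI)
    fix p
    show "card {b \<in> V. b \<in> nbhd E (fst p) \<inter> nbhd E (snd p)} = card (nbhd E (fst p) \<inter> nbhd E (snd p))"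
      using nbhd_subset by (intro arg_cong[of _ _ card]) auto
  qed
  also have "\<dots> \<le> (\<Sum>p\<in>light_pairs T U. T)"
    by (intro sum_mono) (auto simp: light_pairs_def light_def)
  finally have P: "(\<Sum>b\<in>V. card (?P b)) \<le> T * card (light_pairs T U)" by (simp add: mult.commute)
  have D: "(\<Sum>b\<in>V. card (?X b)) = D"
    unfolding D_def by (rule sum_card_nbhd_Int[OF U])
  \<comment> \<open>Cauchy-Schwarz over all \<open>b\<close> in \<open>V\<close>.\<close>
  have "(real D)\<^sup>2 = (\<Sum>b\<in>V. real (card (?X b)))\<^sup>2" by (simp flip: D)
  also have "\<dots> \<le> real (card V) * (\<Sum>b\<in>V. (real (card (?X b)))\<^sup>2)"
    using sum_squared_le_sum_of_squares[of "\<lambda>b. real (card (?X b))" V] finite_V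
    by (cases "V = {}") (auto simp: mult.commute)
  finally have "real (D\<^sup>2) \<le> real (card V * (\<Sum>b\<in>V. (card (?X b))\<^sup>2))" by simp
  then have "D\<^sup>2 \<le> card V * (\<Sum>b\<in>V. (card (?X b))\<^sup>2)" by (simp only: of_nat_le_iff)
  also have "(\<Sum>b\<in>V. (card (?X b))\<^sup>2) \<le> (\<Sum>b\<in>V. t\<^sup>2 * (card (?P b) + card (?X b)))"
    by (intro sum_mono local_bound)
  also have "\<dots> = t\<^sup>2 * ((\<Sum>b\<in>V. card (?P b)) + D)"
    by (simp only: sum_distrib_left[symmetric] sum.distrib D)
  also have "\<dots> \<le> t\<^sup>2 * (T * card (light_pairs T U) + D)"
    using P by simp
  finally show ?thesis by simp
qed

text \<open>The threshold \<open>t\<^sup>2\<close> suffices for the greedy choice, which has to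
  avoid the \<open>t\<close> clique vertices and give distinct connecting vertices to all
  \<open>t choose 2\<close> pairs.\<close>

lemma heavy_clique_copy:
  assumes "K \<subseteq> V" "card K = t" "pairwise (heavy E (t\<^sup>2)) K"
  shows "contains_copy (V, E) (subdivision (complete_graph t))"
proof -
  have finK: "finite K" using assms(1) finite_V by (rule finite_subset)
  let ?A = "\<lambda>e. {w. \<forall>v\<in>e. w \<in> nbhd E v}"
  have "(t choose 2) + t \<le> t\<^sup>2"
    by (cases t) (auto simp: choose_two power2_eq_square)
  moreover have "t\<^sup>2 \<le> card (?A e)" if "e \<in> nsets K 2" for e
  proof -
    obtain x y where e: "e = {x, y}" "x \<in> K" "y \<in> K" "x \<noteq> y"
      using \<open>e \<in> nsets K 2\<close> by (auto simp: nsets_def card_2_iff)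
    then have "?A e = nbhd E x \<inter> nbhd E y" by auto
    then show ?thesis using assms(3) e by (auto simp: pairwise_def heavy_def)
  qed
  moreover have "finite (nsets K 2)" using finK by (rule finite_imp_finite_nsets)
  ultimately have "\<exists>m. inj_on m (nsets K 2) \<and> (\<forall>e\<in>nsets K 2. m e \<in> ?A e - K)"
    using finK assms(2) by (intro distinct_representatives_avoiding) fastforce+
  then obtain m where m: "inj_on m (nsets K 2)" "\<And>e. e \<in> nsets K 2 \<Longrightarrow> m e \<in> ?A e - K" by blast
  have "m e \<in> V - K" if "e \<in> nsets K 2" for e
  proof -
    obtain v where "v \<in> e" using \<open>e \<in> nsets K 2\<close> by (fastforce simp: nsets_def)
    then show ?thesis using m(2)[OF that] nbhd_subset[of v] by auto
  qed
  moreover have "{v, m e} \<in> E" if "e \<in> nsets K 2" "v \<in> e" for e v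
    using m(2)[OF that(1)] that(2) by (auto simp: nbhd_def)
  ultimately show ?thesis
    by (intro contains_subdivisionI[OF assms(1) finK assms(2) m(1)])
qed

section \<open>Growing spread sets inside a reservoir of extensions\<close>

text \<open>Pairs in \<open>S\<close> have a common neighbour by lightness, independence keeps it outside \<open>S\<close>, and the
  last condition makes the common neighbours of different pairs distinct. Lightness bounds the
  number of vertices that such a set excludes from its extensions.\<close>

definition spread :: "nat \<Rightarrow> 'a set \<Rightarrow> bool" where
  "spread T S \<longleftrightarrow> S \<subseteq> V \<and> pairwise (light E T) S \<and> pairwise (\<lambda>x y. y \<notin> nbhd E x) S \<and>
     (\<forall>x\<in>S. \<forall>y\<in>S. \<forall>z\<in>S. x \<noteq> y \<longrightarrow> x \<noteq> z \<longrightarrow> y \<noteq> z \<longrightarrow> nbhd E x \<inter> nbhd E y \<inter> nbhd E z = {})"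

lemma spread_copy:
  assumes "spread T S" "card S = t"
  shows "contains_copy (V, E) (subdivision (complete_graph t))"
proof -
  have S: "S \<subseteq> V" "finite S" using assms(1) finite_V by (auto simp: spread_def intro: finite_subset)
  define m where "m e = (SOME w. \<forall>v\<in>e. w \<in> nbhd E v)" for e
  have m: "m e \<in> nbhd E v" if "e \<in> nsets S 2" "v \<in> e" for e v
  proof -
    obtain x y where e: "e = {x, y}" "x \<in> S" "y \<in> S" "x \<noteq> y"
      using \<open>e \<in> nsets S 2\<close> by (auto simp: nsets_def card_2_iff)
    then have "light E T x y" using assms(1) by (auto simp: spread_def pairwise_def)
    then have "\<exists>w. \<forall>v\<in>e. w \<in> nbhd E v" using e by (auto simp: light_def)
    from someI_ex[OF this] show ?thesis using that by (simp add: m_def)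
  qed
  show ?thesis
  proof (rule contains_subdivisionI[OF S assms(2)])
    show "inj_on m (nsets S 2)"
    proof (rule inj_onI, rule ccontr)
      fix e e' assume e: "e \<in> nsets S 2" "e' \<in> nsets S 2" "m e = m e'" "e \<noteq> e'"
      then obtain x y where xy: "e = {x, y}" "x \<in> S" "y \<in> S" "x \<noteq> y"
        by (auto simp: nsets_def card_2_iff)
      \<comment> \<open>Two different pairs cover at least three vertices, so a shared connecting
        vertex would be adjacent to three elements of \<open>S\<close>.\<close>
      obtain z where z: "z \<in> e'" "z \<notin> e"
      proof -
        have "card e = card e'" "finite e" using e by (auto simp: nsets_def)
        then have "\<not> e' \<subseteq> e" using e(4) by (metis card_subset_eq)
        then show ?thesis using \<open>\<And>z. z \<in> e' \<Longrightarrow> z \<notin> e \<Longrightarrow> thesis\<close> by blast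
      qed
      have "z \<in> S" using z e(2) by (auto simp: nsets_def)
      moreover have "m e \<in> nbhd E x \<inter> nbhd E y \<inter> nbhd E z"
        using m[OF e(1)] m[OF e(2) z(1)] e(3) xy(1) by simp
      moreover have "x \<noteq> z" "y \<noteq> z" using z xy by auto
      ultimately show False using assms(1) xy unfolding spread_def by blast
    qed
  next
    fix e assume e: "e \<in> nsets S 2"
    then obtain x y where xy: "e = {x, y}" "x \<in> S" by (auto simp: nsets_def card_2_iff)
    then have "m e \<in> nbhd E x" using m[OF e] by simp
    moreover have "pairwise (\<lambda>x y. y \<notin> nbhd E x) S" using assms(1) by (simp add: spread_def)
    ultimately have "m e \<notin> S" using xy(2) nbhd_irrefl[of x] by (metis pairwiseD)
    then show "m e \<in> V - S" using \<open>m e \<in> nbhd E x\<close> nbhd_subset by blast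
  next
    fix e v assume "e \<in> nsets S 2" "v \<in> e"
    then show "{v, m e} \<in> E" using m by (auto simp: nbhd_def)
  qed
qed

text \<open>After adding \<open>u\<close>, the light neighbours of \<open>u\<close> in
  \<open>U\<close> remain candidates, except the neighbours of \<open>u\<close> and the vertices
  adjacent to a common neighbour of \<open>u\<close> and some \<open>s\<close> in \<open>S\<close>.
  By lightness there are at most \<open>card S * T\<close> such common neighbours, each with at most
  \<open>\<Delta>\<close> neighbours.\<close>

lemma spread_extension_step:
  assumes S: "finite S" and U: "U \<subseteq> V" "u \<in> U"
    and ext: "\<And>x. x \<in> U \<Longrightarrow> x \<notin> S \<and> spread T (insert x S)"
    and deg: "\<And>v. card (nbhd E v) \<le> \<Delta>"
  shows "\<exists>U'\<subseteq>U. (\<forall>x\<in>U'. x \<notin> insert u S \<and> spread T (insert x (insert u S))) \<and>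
    card {x \<in> U. light E T u x} \<le> card U' + \<Delta> * (1 + card S * T)"
proof -
  define M where "M = (\<Union>s\<in>S. nbhd E u \<inter> nbhd E s)"
  define Bad where "Bad = nbhd E u \<union> (\<Union>w\<in>M. nbhd E w)"
  define U' where "U' = {x \<in> U. light E T u x} - Bad"
  have lightS: "light E T u s" if "s \<in> S" for s
    using ext[OF U(2)] that by (auto simp: spread_def pairwise_insert)
  have "card M \<le> (\<Sum>s\<in>S. card (nbhd E u \<inter> nbhd E s))"
    unfolding M_def by (rule card_UN_le[OF S])
  also have "\<dots> \<le> (\<Sum>s\<in>S. T)"
    by (intro sum_mono less_imp_le) (use lightS in \<open>auto simp: light_def\<close>)
  finally have M: "card M \<le> card S * T" by simp
  have finM: "finite M" using S finite_nbhd by (auto simp: M_def)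
  have "card Bad \<le> card (nbhd E u) + card (\<Union>w\<in>M. nbhd E w)"
    unfolding Bad_def by (rule card_Un_le)
  also have "card (\<Union>w\<in>M. nbhd E w) \<le> (\<Sum>w\<in>M. card (nbhd E w))"
    by (rule card_UN_le[OF finM])
  also have "\<dots> \<le> (\<Sum>w\<in>M. \<Delta>)" by (intro sum_mono deg)
  also have "\<dots> \<le> card S * T * \<Delta>" using M by simp
  finally have "card Bad \<le> \<Delta> * (1 + card S * T)" using deg[of u] by (simp add: algebra_simps)
  moreover have "finite Bad" using finM finite_nbhd by (auto simp: Bad_def)
  then have "card {x \<in> U. light E T u x} \<le> card U' + card Bad"
    using diff_card_le_card_Diff[of Bad "{x \<in> U. light E T u x}"] unfolding U'_def by linarith
  moreover have "x \<notin> insert u S \<and> spread T (insert x (insert u S))" if x: "x \<in> U'" for x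
  proof
    have xU: "x \<in> U" and ux: "light E T u x" "x \<notin> nbhd E u" and "x \<notin> Bad"
      using x by (auto simp: U'_def Bad_def)
    then have M3: "nbhd E u \<inter> nbhd E s \<inter> nbhd E x = {}" if "s \<in> S" for s
      using that nbhd_commute[of _ E x] unfolding Bad_def M_def by blast
    have gu: "spread T (insert u S)" and gx: "spread T (insert x S)" using ext U(2) xU by auto
    have "x \<noteq> u" using ux(1) by (auto simp: light_def)
    then show "x \<notin> insert u S" using ext[OF xU] by simp
    show "spread T (insert x (insert u S))"
      unfolding spread_def
    proof (intro conjI ballI impI)
      show "insert x (insert u S) \<subseteq> V" using gu gx by (auto simp: spread_def)
      show "pairwise (light E T) (insert x (insert u S))"
        using gu gx ux(1) light_commute[of E T u x] unfolding spread_def pairwise_insert by auto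
      show "pairwise (\<lambda>x y. y \<notin> nbhd E x) (insert x (insert u S))"
        using gu gx ux(2) nbhd_commute[of x E u] unfolding spread_def pairwise_insert by auto
    next
      fix a b c
      assume abc: "a \<in> insert x (insert u S)" "b \<in> insert x (insert u S)" "c \<in> insert x (insert u S)"
        "a \<noteq> b" "a \<noteq> c" "b \<noteq> c"
      \<comment> \<open>A triple that omits \<open>x\<close> or \<open>u\<close> is covered by a
        spread set already known; only triples with both are new.\<close>
      consider "{a, b, c} \<subseteq> insert u S" | "{a, b, c} \<subseteq> insert x S"
        | s where "s \<in> S" "{a, b, c} = {u, s, x}"
        using abc \<open>x \<noteq> u\<close> by auto
      moreover have triple: "nbhd E a \<inter> nbhd E b \<inter> nbhd E c = {}" if "spread T R" "{a, b, c} \<subseteq> R" for R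
        using that abc(4-6) unfolding spread_def by simp
      ultimately show "nbhd E a \<inter> nbhd E b \<inter> nbhd E c = {}"
      proof cases
        case 1
        then show ?thesis using triple[OF gu] by simp
      next
        case 2
        then show ?thesis using triple[OF gx] by simp
      next
        case 3
        have "nbhd E a \<inter> nbhd E b \<inter> nbhd E c = \<Inter> (nbhd E ` {a, b, c})" by auto
        also have "\<dots> = nbhd E u \<inter> nbhd E s \<inter> nbhd E x" unfolding 3(2) by auto
        finally show ?thesis using M3[OF 3(1)] by simp
      qed
    qed
  qed
  ultimately show ?thesis
    by (intro exI[of _ U']) (auto simp: U'_def)
qed

text \<open>Invariant: \<open>U\<close> is a reservoir of vertices each of which extends
  \<open>S\<close>, and one step shrinks it by a factor \<open>q\<close> at worst. Of the
  \<open>2 * q * card U\<close> light neighbours granted by \<open>big\<close>, at most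
  \<open>q * card U\<close> are discarded, by \<open>removed\<close>. While steps remain, the
  reservoir is large enough for \<open>big\<close>.\<close>

lemma spread_set_exists:
  fixes q :: real
  assumes A: "A \<subseteq> V" and q: "0 < q" "q \<le> 1"
    and deg: "\<And>v. card (nbhd E v) \<le> \<Delta>"
    and big: "\<And>U. U \<subseteq> A \<Longrightarrow> q ^ t * card A \<le> card U \<Longrightarrow>
      \<exists>u\<in>U. 2 * q * card U \<le> card {x \<in> U. light E T u x}"
    and removed: "real (\<Delta> * (1 + t * T)) \<le> q ^ Suc t * card A"
    and "i \<le> t"
  shows "\<exists>S U. card S = i \<and> finite S \<and> spread T S \<and> U \<subseteq> A \<and> q ^ i * card A \<le> card U \<and>
    (\<forall>x\<in>U. x \<notin> S \<and> spread T (insert x S))"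
  using \<open>i \<le> t\<close>
proof (induction i)
  case 0
  have "spread T {}" "\<And>x. x \<in> A \<Longrightarrow> spread T {x}" using A by (auto simp: spread_def pairwise_def)
  then show ?case by (intro exI[of _ "{}"] exI[of _ A]) auto
next
  case (Suc i)
  then obtain S U where S: "card S = i" "finite S" "spread T S"
    and U: "U \<subseteq> A" "q ^ i * card A \<le> card U" and ext: "\<And>x. x \<in> U \<Longrightarrow> x \<notin> S \<and> spread T (insert x S)"
    by auto
  have "q ^ t * card A \<le> q ^ i * card A"
    using q Suc.prems by (intro mult_right_mono power_decreasing) auto
  then have Ut: "q ^ t * card A \<le> card U" using U(2) by linarith
  then obtain u where u: "u \<in> U" "2 * q * card U \<le> card {x \<in> U. light E T u x}"
    using big U(1) by blast
  obtain U' where U': "U' \<subseteq> U" "\<forall>x\<in>U'. x \<notin> insert u S \<and> spread T (insert x (insert u S))"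
    "card {x \<in> U. light E T u x} \<le> card U' + \<Delta> * (1 + card S * T)"
    using spread_extension_step[OF S(2) _ u(1) ext deg] U(1) A by auto
  have "\<Delta> * (1 + card S * T) \<le> \<Delta> * (1 + t * T)" using S(1) Suc.prems by simp
  then have "real (\<Delta> * (1 + card S * T)) \<le> real (\<Delta> * (1 + t * T))" by (simp only: of_nat_le_iff)
  also have "\<dots> \<le> q ^ Suc t * card A" using removed .
  also have "\<dots> \<le> q * card U" using Ut q by (simp add: mult.assoc mult_left_mono)
  finally have "real (\<Delta> * (1 + card S * T)) \<le> q * card U" .
  moreover have "real (card {x \<in> U. light E T u x}) \<le> card U' + real (\<Delta> * (1 + card S * T))"
    using U'(3) by (simp only: of_nat_add[symmetric] of_nat_le_iff)
  ultimately have "q * card U \<le> card U'" using u(2) by linarith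
  moreover have "q ^ Suc i * card A \<le> q * card U"
    using U(2) q by (simp add: mult.assoc mult_left_mono)
  ultimately have "q ^ Suc i * card A \<le> card U'" by linarith
  moreover have "card (insert u S) = Suc i" "finite (insert u S)" "spread T (insert u S)" "U' \<subseteq> A"
    using S U(1) U'(1) ext[OF u(1)] by auto
  ultimately show ?case using U'(2) by blast
qed

text \<open>If no copy exists, there are no heavy cliques, so every reservoir \<open>U\<close> spans
  many light pairs. The condition \<open>dense\<close> absorbs the linear term of
  \<open>light_pairs_lower_bound\<close>, and \<open>q\<delta>\<close> then gives at least
  \<open>2 * q * (card U)\<^sup>2\<close> ordered light pairs. By averaging, some \<open>u\<close>
  has the light degree that the growth of a spread set requires.\<close>

lemma copy_exists:
  fixes q \<delta> :: real
  assumes A: "A \<subseteq> V" "A \<noteq> {}" and t: "0 < t" and q: "0 < q" "q \<le> 1"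
    and deg: "\<And>v. card (nbhd E v) \<le> \<Delta>"
    and mindeg: "\<And>v. v \<in> A \<Longrightarrow> \<delta> \<le> card (nbhd E v)" and \<delta>: "0 \<le> \<delta>"
    and dense: "2 * card V * t\<^sup>2 \<le> \<delta> * (q ^ t * card A)"
    and removed: "real (\<Delta> * (1 + t * t\<^sup>2)) \<le> q ^ Suc t * card A"
    and q\<delta>: "4 * q * real (card V) * real t ^ 4 \<le> \<delta>\<^sup>2"
  shows "contains_copy (V, E) (subdivision (complete_graph t))"
proof (rule ccontr)
  assume no_copy: "\<not> ?thesis"
  let ?T = "t\<^sup>2"
  have n: "0 < card V" using A finite_V by (auto simp: card_gt_0_iff)
  have "\<exists>u\<in>U. 2 * q * card U \<le> card {x \<in> U. light E ?T u x}"
    if U: "U \<subseteq> A" "q ^ t * card A \<le> card U" for U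
  proof (rule ccontr)
    assume "\<not> ?thesis"
    then have less: "card {x \<in> U. light E ?T u x} < 2 * q * card U" if "u \<in> U" for u
      using that by force
    have finU: "finite U" using U A finite_V by (meson finite_subset)
    have "0 < q ^ t * card A" using q A finite_V by (auto simp: card_gt_0_iff finite_subset)
    then have cU: "0 < card U" using U(2) by linarith
    define D where "D = (\<Sum>u\<in>U. card (nbhd E u))"
    have "\<delta> * card U = (\<Sum>u\<in>U. \<delta>)" by simp
    also have "\<dots> \<le> D" unfolding D_def of_nat_sum using U(1) mindeg by (intro sum_mono) auto
    finally have D\<delta>: "\<delta> * card U \<le> D" .
    have Dn: "2 * card V * t\<^sup>2 \<le> real D"
      using dense D\<delta> mult_left_mono[OF U(2) \<delta>] by linarith
    have "D\<^sup>2 \<le> card V * (t\<^sup>2 * (?T * card (light_pairs ?T U) + D))"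
      unfolding D_def using U A t heavy_clique_copy no_copy
      by (intro light_pairs_lower_bound) auto
    then have "real (D\<^sup>2) \<le> real (card V * (t\<^sup>2 * (?T * card (light_pairs ?T U) + D)))"
      by (simp only: of_nat_le_iff)
    then have "(real D)\<^sup>2 \<le> card V * t ^ 4 * card (light_pairs ?T U) + (card V * t\<^sup>2) * D"
      by (simp add: algebra_simps power4_eq_xxxx power2_eq_square)
    \<comment> \<open>This makes the linear term at most half of \<open>D\<^sup>2\<close>.\<close>
    moreover have "(2 * card V * t\<^sup>2) * real D \<le> real D * real D"
      using Dn by (intro mult_right_mono) auto
    ultimately have L: "(real D)\<^sup>2 \<le> 2 * card V * t ^ 4 * card (light_pairs ?T U)"
      by (simp add: power2_eq_square)
    have "light_pairs ?T U = (SIGMA u:U. {x \<in> U. light E ?T u x})" by (auto simp: light_pairs_def)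
    then have "real (card (light_pairs ?T U)) = (\<Sum>u\<in>U. real (card {x \<in> U. light E ?T u x}))"
      using finU by simp
    also have "\<dots> < (\<Sum>u\<in>U. 2 * q * card U)"
      using finU cU less by (intro sum_strict_mono) auto
    finally have "real (card (light_pairs ?T U)) < 2 * q * card U * card U" by (simp add: mult.commute)
    then have "2 * card V * t ^ 4 * real (card (light_pairs ?T U))
        < 2 * card V * t ^ 4 * (2 * q * card U * card U)"
      using n t by (intro mult_strict_left_mono) auto
    also have "\<dots> = (4 * q * card V * t ^ 4) * (card U)\<^sup>2" by (simp add: power2_eq_square)
    also have "\<dots> \<le> \<delta>\<^sup>2 * (card U)\<^sup>2" using q\<delta> by (intro mult_right_mono) auto
    also have "\<dots> = (\<delta> * card U)\<^sup>2" by (simp add: power_mult_distrib)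
    also have "\<dots> \<le> (real D)\<^sup>2" using D\<delta> \<delta> by (intro power_mono) auto
    finally show False using L by (metis not_less of_nat_mult)
  qed
  then have "\<exists>S U. card S = t \<and> finite S \<and> spread ?T S \<and> U \<subseteq> A \<and> q ^ t * card A \<le> card U \<and>
      (\<forall>x\<in>U. x \<notin> S \<and> spread ?T (insert x S))"
    by (intro spread_set_exists[OF A(1) q deg _ removed order_refl])
  then obtain S where "card S = t" "spread ?T S" by blast
  with spread_copy no_copy show False by blast
qed

text \<open>Inserting the trivial bound \<open>(card U)\<^sup>2\<close> on the number of light pairs
  into \<open>light_pairs_lower_bound\<close> gives a quadratic inequality for the degree sum. The
  bound serves both to limit the edges at high-degree vertices and to show that many vertices have
  decent degree.\<close>

lemma degree_sum_bound:
  assumes U: "U \<subseteq> V" and t: "0 < t"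
    and no_copy: "\<not> contains_copy (V, E) (subdivision (complete_graph t))"
  shows "(\<Sum>u\<in>U. card (nbhd E u)) \<le> 2 * t\<^sup>2 * (card V + sqrt (card V) * card U)"
proof (rule ccontr)
  assume less: "\<not> ?thesis"
  define D where "D = (\<Sum>u\<in>U. card (nbhd E u))"
  define n where "n = real (card V)"
  define P where "P = t\<^sup>2 * n"
  define Q where "Q = t\<^sup>2 * (sqrt n * card U)"
  let ?T = "t\<^sup>2"
  have big: "2 * t\<^sup>2 * (n + sqrt n * card U) < D"
    using less by (simp add: D_def n_def)
  have "card (light_pairs ?T U) \<le> card (U \<times> U)"
    using U finite_V by (intro card_mono) (auto simp: light_pairs_def finite_subset)
  then have L: "card (light_pairs ?T U) \<le> (card U)\<^sup>2"
    by (simp only: card_cartesian_product power2_eq_square[of "card U"])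
  have "D\<^sup>2 \<le> card V * (t\<^sup>2 * (?T * card (light_pairs ?T U) + D))"
    unfolding D_def using U t heavy_clique_copy no_copy
    by (intro light_pairs_lower_bound) auto
  also have "\<dots> \<le> card V * (t\<^sup>2 * (?T * (card U)\<^sup>2 + D))" using L by simp
  finally have "real (D\<^sup>2) \<le> real (card V * (t\<^sup>2 * (?T * (card U)\<^sup>2 + D)))"
    by (simp only: of_nat_le_iff)
  then have "real D * D \<le> n * t\<^sup>2 * t\<^sup>2 * (card U)\<^sup>2 + (t\<^sup>2 * n) * D"
    by (simp add: n_def power2_eq_square algebra_simps)
  also have "n * t\<^sup>2 * t\<^sup>2 * (card U)\<^sup>2 = (t\<^sup>2 * (sqrt n * card U)) * (t\<^sup>2 * (sqrt n * card U))"
    by (simp add: n_def power2_eq_square algebra_simps)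
  finally have up: "real D * D \<le> Q * Q + P * D" by (simp only: P_def Q_def)
  have pos: "0 \<le> P" "0 \<le> Q" by (auto simp: n_def P_def Q_def)
  have D: "2 * P + 2 * Q < D" using big by (simp add: P_def Q_def algebra_simps)
  \<comment> \<open>Here \<open>Q * Q\<close> is at most \<open>Q * D / 2\<close>, and
    \<open>P * D + Q * D\<close> is at most half of \<open>D * D\<close>; so the right side of
    \<open>up\<close> is at most half of \<open>D * D\<close>, a contradiction.\<close>
  have "(2 * P + 2 * Q) * D \<le> real D * D" "Q * (2 * P + 2 * Q) \<le> Q * D"
    using D pos by (auto intro!: mult_right_mono mult_left_mono)
  moreover have "0 \<le> Q * P" "0 \<le> Q * Q" using pos by auto
  moreover have "0 < real D * D" using D pos by simp
  ultimately show False using up unfolding distrib_left distrib_right by linarith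
qed

end

section \<open>Removing high-degree vertices and choosing the parameters as powers of
  \<open>n\<close>\<close>

lemma contains_copy_mono:
  "contains_copy (V, E') H \<Longrightarrow> E' \<subseteq> E \<Longrightarrow> contains_copy (V, E) H"
  unfolding contains_copy_def fst_conv snd_conv by (meson subsetD)

text \<open>With \<open>\<epsilon> = 1 / 6 ^ t\<close> this says
  \<open>\<epsilon> * (3 + 2 * t) \<le> 1 / 8\<close>, the budget for all losses in the exponent of
  \<open>n\<close>.\<close>

lemma six_power_bound:
  assumes "3 \<le> (t::nat)"
  shows "8 * (3 + 2 * t) \<le> 6 ^ t"
  using assms by (induction t rule: dec_induct) auto

lemma (in fin_graph) card_edges_le_remove:
  assumes "finite S"
  shows "card E \<le> card {e \<in> E. e \<inter> S = {}} + (\<Sum>v\<in>S. card (nbhd E v))"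
proof -
  have "E \<subseteq> {e \<in> E. e \<inter> S = {}} \<union> (\<Union>v\<in>S. {e \<in> E. v \<in> e})" by auto
  then have "card E \<le> card ({e \<in> E. e \<inter> S = {}} \<union> (\<Union>v\<in>S. {e \<in> E. v \<in> e}))"
    using finite_E assms by (intro card_mono) auto
  also have "\<dots> \<le> card {e \<in> E. e \<inter> S = {}} + card (\<Union>v\<in>S. {e \<in> E. v \<in> e})"
    by (rule card_Un_le)
  also have "card (\<Union>v\<in>S. {e \<in> E. v \<in> e}) \<le> (\<Sum>v\<in>S. card {e \<in> E. v \<in> e})"
    by (rule card_UN_le[OF assms])
  finally show ?thesis by (simp add: card_nbhd)
qed

text \<open>An excess of edges yields the parameters of \<open>copy_exists\<close>: maximum degree
  \<open>n powr (3 / 4)\<close>, a set \<open>A\<close> of size at least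
  \<open>n powr (1 - \<epsilon>)\<close>, minimum degree of order
  \<open>n powr (1 / 2 - \<epsilon>)\<close> on it, and
  \<open>q = n powr (- 2 * \<epsilon>)\<close>. The hypothesis \<open>large\<close> absorbs the
  factors that depend on \<open>t\<close>.\<close>

lemma (in fin_graph) card_edges_bound:
  fixes t :: nat
  defines "n \<equiv> real (card V)" and "\<epsilon> \<equiv> 1 / 6 ^ t :: real"
  assumes t: "3 \<le> t" and large: "4 * real t ^ 3 \<le> n powr (1 / 8)"
    and no_copy: "\<not> contains_copy (V, E) (subdivision (complete_graph t))"
  shows "card E \<le> 8 * t\<^sup>2 * n powr (3 / 2 - \<epsilon>)"
proof (rule ccontr)
  define e where "e = real (card E)"
  assume "\<not> card E \<le> 8 * t\<^sup>2 * n powr (3 / 2 - \<epsilon>)"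
  then have e: "8 * t\<^sup>2 * n powr (3 / 2 - \<epsilon>) < e" by (simp add: e_def)
  have t3: "(1::real) \<le> t ^ 3" "real t ^ 2 \<le> t ^ 3" using t by (auto intro: power_increasing)
  have "n \<noteq> 0" using large t3 by (intro notI) simp
  then have n: "1 \<le> n" by (simp add: n_def)
  have "real (8 * (3 + 2 * t)) \<le> real (6 ^ t)"
    using six_power_bound[OF t] by (simp only: of_nat_le_iff)
  then have \<epsilon>: "\<epsilon> * (3 + 2 * t) \<le> 1 / 8" by (simp add: \<epsilon>_def field_simps)
  have \<epsilon>0: "0 < \<epsilon>" by (simp add: \<epsilon>_def)
  have \<epsilon>t: "0 \<le> \<epsilon> * t" "\<epsilon> * 3 + 2 * (\<epsilon> * t) \<le> 1 / 8"
    using \<epsilon> \<epsilon>0 by (auto simp: algebra_simps)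
  have mono: "n powr a \<le> n powr b" if "a \<le> b" for a b using that n by (intro powr_mono) auto
  have "n powr 1 \<le> n powr (3 / 2 - \<epsilon>)" using \<epsilon>t \<epsilon>0 by (intro mono) linarith
  then have "8 * t\<^sup>2 * n \<le> 8 * t\<^sup>2 * n powr (3 / 2 - \<epsilon>)" using n by (intro mult_left_mono) auto
  then have en: "8 * t\<^sup>2 * n < e" using e by linarith
  have sqrt_n: "sqrt n = n powr (1 / 2)" using n by (simp add: powr_half_sqrt)

  \<comment> \<open>Degrees above \<open>n powr (3 / 4)\<close> exceed \<open>sqrt n\<close> by a
    factor of at least \<open>4 * t\<^sup>2\<close>, so the term with \<open>sqrt n * card S\<close>
    in \<open>degree_sum_bound\<close> is at most half of \<open>DS\<close>, and \<open>DS\<close>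
    is linear in \<open>n\<close>.\<close>
  define S where "S = {v \<in> V. n powr (3 / 4) < card (nbhd E v)}"
  define DS where "DS = real (\<Sum>v\<in>S. card (nbhd E v))"
  have S: "S \<subseteq> V" "finite S" using finite_V by (auto simp: S_def)
  have "DS \<le> 2 * t\<^sup>2 * (n + sqrt n * card S)"
    unfolding DS_def n_def using degree_sum_bound[OF S(1) _ no_copy] t by auto
  moreover have "4 * t\<^sup>2 * (sqrt n * card S) \<le> DS"
  proof -
    have "4 * t\<^sup>2 \<le> n powr (1 / 4)" using large t3 mono[of "1 / 8" "1 / 4"] by simp
    then have "4 * t\<^sup>2 * (sqrt n * card S) \<le> n powr (1 / 4) * (sqrt n * card S)"
      using n by (intro mult_right_mono) auto
    also have "\<dots> = (n powr (1 / 4) * n powr (1 / 2)) * card S" by (simp add: sqrt_n)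
    also have "\<dots> = (\<Sum>v\<in>S. n powr (3 / 4))" by (simp add: powr_add[symmetric])
    also have "\<dots> \<le> DS" unfolding DS_def of_nat_sum by (intro sum_mono) (auto simp: S_def)
    finally show ?thesis .
  qed
  ultimately have DS: "DS \<le> 4 * t\<^sup>2 * n" by (simp add: algebra_simps)

  \<comment> \<open>The vertices of \<open>S\<close> become isolated but stay in \<open>V\<close>,
    so \<open>n\<close> is unchanged.\<close>
  define E' where "E' = {e \<in> E. e \<inter> S = {}}"
  interpret G': fin_graph V E'
    using finite_V edges_subset by unfold_locales (auto simp: E'_def)
  have no_copy': "\<not> contains_copy (V, E') (subdivision (complete_graph t))"
    using no_copy by (rule contrapos_nn) (auto simp: E'_def intro: contains_copy_mono)
  have "real (card E) \<le> real (card E' + (\<Sum>v\<in>S. card (nbhd E v)))"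
    using card_edges_le_remove[OF S(2)] unfolding E'_def of_nat_le_iff .
  then have e': "e - 4 * t\<^sup>2 * n \<le> card E'" using DS by (simp add: e_def DS_def)
  have deg: "card (nbhd E' v) \<le> n powr (3 / 4)" for v
  proof (cases "v \<in> V - S")
    case True
    have "nbhd E' v \<subseteq> nbhd E v" by (auto simp: nbhd_def E'_def)
    then have "card (nbhd E' v) \<le> card (nbhd E v)" by (rule card_mono[OF finite_nbhd])
    moreover have "card (nbhd E v) \<le> n powr (3 / 4)" using True by (auto simp: S_def)
    ultimately show ?thesis by linarith
  next
    case False
    then have "nbhd E' v = {}" using edges_subset by (auto simp: nbhd_def E'_def nsets_def)
    then show ?thesis by simp
  qed

  \<comment> \<open>Since \<open>card E'\<close> exceeds \<open>e / 2\<close>, this is at most half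
    of the average degree for \<open>E'\<close>. Vertices of smaller degree contribute at most
    \<open>e / 2\<close> to a degree sum larger than \<open>e\<close>.\<close>
  define \<delta> where "\<delta> = e / (2 * n)"
  define A where "A = {v \<in> V. \<delta> \<le> card (nbhd E' v)}"
  have A: "A \<subseteq> V" by (auto simp: A_def)
  have "real (\<Sum>v\<in>V. card (nbhd E' v)) = (\<Sum>v\<in>V - A. real (card (nbhd E' v))) + real (\<Sum>v\<in>A. card (nbhd E' v))"
    unfolding of_nat_sum by (rule sum.subset_diff[OF A finite_V])
  moreover have "(\<Sum>v\<in>V - A. real (card (nbhd E' v))) \<le> (\<Sum>v\<in>V - A. \<delta>)"
    by (intro sum_mono) (auto simp: A_def)
  moreover have "(\<Sum>v\<in>V - A. \<delta>) \<le> (\<Sum>v\<in>V. \<delta>)"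
    using finite_V by (intro sum_mono2) (auto simp: \<delta>_def e_def n_def)
  moreover have "(\<Sum>v\<in>V. \<delta>) = e / 2" using n by (simp add: \<delta>_def flip: n_def)
  ultimately have "e / 2 \<le> real (\<Sum>v\<in>A. card (nbhd E' v))"
    using e' en by (simp add: G'.sum_card_nbhd)
  moreover have "real (\<Sum>v\<in>A. card (nbhd E' v)) \<le> 2 * t\<^sup>2 * (n + sqrt n * card A)"
    using G'.degree_sum_bound[OF A _ no_copy'] t by (auto simp: n_def)
  \<comment> \<open>By \<open>en\<close> the term \<open>2 * t\<^sup>2 * n\<close> is below
    \<open>e / 4\<close>.\<close>
  ultimately have "e / 4 \<le> 2 * t\<^sup>2 * (sqrt n * card A)"
    using en by (simp add: algebra_simps)
  then have "t\<^sup>2 * n powr (3 / 2 - \<epsilon>) \<le> t\<^sup>2 * (sqrt n * card A)" using e by simp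
  then have "n powr (3 / 2 - \<epsilon>) \<le> n powr (1 / 2) * card A"
    using t by (simp add: sqrt_n)
  moreover have "n powr (3 / 2 - \<epsilon>) = n powr (1 / 2) * n powr (1 - \<epsilon>)"
    by (simp add: powr_add[symmetric])
  ultimately have cA: "n powr (1 - \<epsilon>) \<le> card A" using n by simp
  then have "A \<noteq> {}" using n by auto

  have "4 * t\<^sup>2 * n powr (1 / 2 - \<epsilon>) = 8 * t\<^sup>2 * n powr (3 / 2 - \<epsilon>) / (2 * n)"
  proof -
    have "n powr (3 / 2 - \<epsilon>) = n powr (1 / 2 - \<epsilon>) * n powr 1" by (simp only: powr_add[symmetric]) simp
    then show ?thesis using n by simp
  qed
  also have "\<dots> \<le> \<delta>" unfolding \<delta>_def using e n by (intro divide_right_mono) auto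
  finally have \<delta>: "4 * t\<^sup>2 * n powr (1 / 2 - \<epsilon>) \<le> \<delta>" .
  \<comment> \<open>The exponent balances \<open>q\<delta>\<close>: both \<open>q * n\<close> and
    the square of \<open>n powr (1 / 2 - \<epsilon>)\<close> equal
    \<open>n powr (1 - 2 * \<epsilon>)\<close>.\<close>
  define q where "q = n powr (- 2 * \<epsilon>)"
  have q_power: "q ^ k = n powr (- 2 * \<epsilon> * k)" for k
    using n by (simp add: q_def powr_realpow[symmetric] powr_powr)

  have "contains_copy (V, E') (subdivision (complete_graph t))"
  proof (rule G'.copy_exists[OF A \<open>A \<noteq> {}\<close>, where q = q and \<delta> = \<delta> and \<Delta> = "nat \<lfloor>n powr (3 / 4)\<rfloor>"])
    show "0 < t" using t by simp
    show "0 < q" using n by (simp add: q_def)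
    show "q \<le> 1" using mono[of "- 2 * \<epsilon>" 0] \<epsilon>0 n by (simp add: q_def)
    show "card (nbhd E' v) \<le> nat \<lfloor>n powr (3 / 4)\<rfloor>" for v
      using deg by (rule le_nat_floor)
    show "\<delta> \<le> card (nbhd E' v)" if "v \<in> A" for v using that by (simp add: A_def)
    show \<delta>0: "0 \<le> \<delta>" by (simp add: \<delta>_def e_def n_def)
    show "2 * card V * t\<^sup>2 \<le> \<delta> * (q ^ t * card A)"
    proof -
      \<comment> \<open>The exponent on the right is
        \<open>3 / 2 - 2 * \<epsilon> - 2 * \<epsilon> * t\<close>, which is well above 1.\<close>
      have "2 * t\<^sup>2 * n powr 1 \<le> 4 * t\<^sup>2 * n powr (1 / 2 - \<epsilon> + (- 2 * \<epsilon> * t + (1 - \<epsilon>)))"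
        using \<epsilon>t \<epsilon>0 by (intro mult_mono mono) auto
      also have "\<dots> = (4 * t\<^sup>2 * n powr (1 / 2 - \<epsilon>)) * (q ^ t * n powr (1 - \<epsilon>))"
        by (simp only: powr_add q_power mult.assoc)
      also have "\<dots> \<le> \<delta> * (q ^ t * card A)"
        using \<delta> cA \<delta>0 by (intro mult_mono) (auto simp: q_def)
      finally show ?thesis using n by (simp add: n_def mult.commute mult.left_commute)
    qed
    show "real (nat \<lfloor>n powr (3 / 4)\<rfloor> * (1 + t * t\<^sup>2)) \<le> q ^ Suc t * card A"
    proof -
      have "1 + t * (real t)\<^sup>2 \<le> n powr (1 / 8)"
        using large t3 by (simp add: power3_eq_cube power2_eq_square mult.assoc)
      moreover have "real (nat \<lfloor>n powr (3 / 4)\<rfloor>) \<le> n powr (3 / 4)" by simp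
      ultimately have "real (nat \<lfloor>n powr (3 / 4)\<rfloor> * (1 + t * t\<^sup>2)) \<le> n powr (3 / 4) * n powr (1 / 8)"
        unfolding of_nat_mult of_nat_add of_nat_power of_nat_1 by (intro mult_mono) auto
      also have "\<dots> = n powr (7 / 8)" by (simp add: powr_add[symmetric])
      \<comment> \<open>The right exponent is \<open>1 - \<epsilon> * (3 + 2 * t)\<close>; this is
        where the whole budget of \<open>1 / 8\<close> is spent.\<close>
      also have "\<dots> \<le> n powr (- 2 * \<epsilon> * Suc t + (1 - \<epsilon>))"
        using \<epsilon>t by (intro mono) (simp add: algebra_simps)
      also have "\<dots> = q ^ Suc t * n powr (1 - \<epsilon>)" by (simp only: powr_add q_power)
      also have "\<dots> \<le> q ^ Suc t * card A" using cA by (intro mult_left_mono) (auto simp: q_def)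
      finally show ?thesis .
    qed
    show "4 * q * real (card V) * real t ^ 4 \<le> \<delta>\<^sup>2"
    proof -
      have "q * n powr 1 = n powr (1 / 2 - \<epsilon>) * n powr (1 / 2 - \<epsilon>)"
        unfolding q_def powr_add[symmetric] by simp
      then have "16 * (q * n * t ^ 4) = (4 * t\<^sup>2 * n powr (1 / 2 - \<epsilon>))\<^sup>2"
        using n by (simp add: power2_eq_square power4_eq_xxxx)
      also have "\<dots> \<le> \<delta>\<^sup>2" using \<delta> by (intro power_mono) auto
      finally have "16 * (q * n * t ^ 4) \<le> \<delta>\<^sup>2" .
      moreover have "0 \<le> q * n * t ^ 4" using n by (simp add: q_def)
      ultimately have "4 * (q * n * t ^ 4) \<le> \<delta>\<^sup>2" by linarith
      then show ?thesis by (simp add: n_def mult.assoc)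
    qed
  qed
  with no_copy' show False by blast
qed

section \<open>Passage to the extremal number, with small \<open>n\<close> absorbed in the
  constant\<close>

theorem theorem5p1:
  fixes t :: nat
  assumes "t \<ge> 3"
  shows "\<exists>C :: real. \<forall>n :: nat.
           real (ex n (subdivision (complete_graph t))) \<le> C * real n powr (3 / 2 - 1 / 6 ^ t)"
proof (intro exI allI)
  fix n :: nat
  define H where "H = subdivision (complete_graph t)"
  \<comment> \<open>From \<open>m\<close> on, \<open>n powr (1 / 8)\<close> is at least
    \<open>4 * t ^ 3\<close>, as \<open>card_edges_bound\<close> requires. Below \<open>m\<close>
    there are at most \<open>m\<^sup>2\<close> edges, hence the summand \<open>m\<^sup>2\<close> in
    the constant.\<close>
  define m where "m = (4 * t ^ 3) ^ 8"
  define p where "p = 3 / 2 - 1 / (6 :: real) ^ t"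
  have p: "0 \<le> p"
  proof -
    have "1 / 6 ^ t \<le> (1::real)" by simp
    then show ?thesis unfolding p_def by linarith
  qed
  let ?R = "{card (edges G) | G :: nat graph.
    simple_graph G \<and> card (verts G) = n \<and> \<not> contains_copy G H}"
  have "ex n H \<in> ?R"
    unfolding ex_def using edges_subdivision_complete_graph[of t] assms
    by (intro Max_in ex_set_finite ex_set_nonempty) (auto simp: H_def)
  then obtain V E where VE: "simple_graph (V :: nat set, E)" "card V = n"
    "\<not> contains_copy (V, E) H" "ex n H = card E"
    by auto
  interpret fin_graph V E using VE(1) by unfold_locales (auto simp: simple_graph_def)
  have "card E \<le> (8 * t\<^sup>2 + m\<^sup>2) * n powr p"
  proof (cases "m \<le> n")
    case True
    have x: "0 < 4 * real t ^ 3" using assms by simp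
    have "real m = (4 * real t ^ 3) powr 8"
      unfolding m_def powr_numeral[OF less_imp_le[OF x]] by simp
    then have "4 * real t ^ 3 = (real m) powr (1 / 8)"
      using x by (simp only: powr_powr) simp
    also have "\<dots> \<le> n powr (1 / 8)" using True by (intro powr_mono2) auto
    finally have "card E \<le> 8 * t\<^sup>2 * n powr p"
      using card_edges_bound[OF assms] VE by (simp add: H_def p_def)
    also have "\<dots> \<le> (8 * t\<^sup>2 + m\<^sup>2) * n powr p" by (intro mult_right_mono) auto
    finally show ?thesis .
  next
    case False
    have "card E \<le> card (nsets V 2)"
      using edges_subset finite_V by (intro card_mono finite_imp_finite_nsets)
    then have cE: "card E \<le> n choose 2" using VE(2) by simp
    \<comment> \<open>For \<open>n = 0\<close> the power of \<open>n\<close> is 0, but so is the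
      number of edges; for positive \<open>n\<close> it is at least 1.\<close>
    show ?thesis
    proof (cases "n = 0")
      case True
      then show ?thesis using cE by (simp add: binomial_eq_0)
    next
      case nz: False
      have "n choose 2 \<le> n * (n - 1)" by (simp add: choose_two)
      also have "\<dots> \<le> n\<^sup>2" by (simp add: power2_eq_square)
      also have "\<dots> \<le> m\<^sup>2" using False by simp
      finally have "card E \<le> real (m\<^sup>2)" using cE by (meson le_trans of_nat_le_iff)
      also have "\<dots> \<le> real (8 * t\<^sup>2 + m\<^sup>2) * 1" by simp
      also have "\<dots> \<le> real (8 * t\<^sup>2 + m\<^sup>2) * n powr p"
        using nz p by (intro mult_left_mono ge_one_powr_ge_zero) auto
      finally show ?thesis by simp
    qed
  qed
  then show "real (ex n (subdivision (complete_graph t)))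
      \<le> (8 * real t ^ 2 + real ((4 * t ^ 3) ^ 8) ^ 2) * real n powr (3 / 2 - 1 / 6 ^ t)"
    using VE(4) by (simp add: H_def m_def p_def)
qed

end
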